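(* For every positive integer $r$, the Ramsey number of the $r$-dimensional cube satisfies $r(Q_r)\le 2^{3r}$.
   Context: The $r$-cube $Q_r$ is the graph with vertex set $\{0,1\}^r$ in which two vectors are adjacent if and only if they differ in exactly one coordinate. For a graph $H$, the Ramsey number $r(H)$ is the minimum positive integer $N$ such that every $2$-coloring of the edges of the complete graph $K_N$ contains a monochromatic copy of $H$. *)

theory Defs
  imports "HOL-Library.Ramsey"
begin

text \<open>
  A graph is a pair of its vertex set and its edge set, edges being two-element sets of
  vertices as in the library theory on Ramsey's theorem.
\<close>

type_synonym 'a graph = "'a set \<times> 'a set set"

abbreviation graph_verts :: "'a graph \<Rightarrow> 'a set" where
  "graph_verts G \<equiv> fst G"

abbreviation graph_edges :: "'a graph \<Rightarrow> 'a set set" where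
  "graph_edges G \<equiv> snd G"

definition simple_graph :: "'a graph \<Rightarrow> bool" where
  "simple_graph G \<longleftrightarrow> finite (graph_verts G) \<and> graph_edges G \<subseteq> [graph_verts G]\<^bsup>2\<^esup>"

definition complete_graph :: "nat \<Rightarrow> nat graph" where
  "complete_graph N = ({..<N}, [{..<N}]\<^bsup>2\<^esup>)"

text \<open>The vectors are extensional functions, so distinct ones differ at some coordinate below \<open>r\<close>.\<close>

definition cube :: "nat \<Rightarrow> (nat \<Rightarrow> nat) graph" where
  "cube r =
     ({..<r} \<rightarrow>\<^sub>E {0, 1},
      {{x, y} | x y. x \<in> {..<r} \<rightarrow>\<^sub>E {0, 1} \<and> y \<in> {..<r} \<rightarrow>\<^sub>E {0, 1} \<and>
                     card {i. i < r \<and> x i \<noteq> y i} = 1})"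

text \<open>Copies are subgraphs, not necessarily induced.\<close>

definition contains_copy :: "'b graph \<Rightarrow> 'a graph \<Rightarrow> bool" where
  "contains_copy G H \<longleftrightarrow>
     (\<exists>\<phi>. inj_on \<phi> (graph_verts H) \<and> \<phi> ` graph_verts H \<subseteq> graph_verts G \<and>
          (\<forall>e \<in> graph_edges H. \<phi> ` e \<in> graph_edges G))"

definition color_class :: "'a graph \<Rightarrow> ('a set \<Rightarrow> nat) \<Rightarrow> nat \<Rightarrow> 'a graph" where
  "color_class G f c = (graph_verts G, {e \<in> graph_edges G. f e = c})"

definition ramsey_for :: "'a graph \<Rightarrow> nat \<Rightarrow> bool" where
  "ramsey_for H N \<longleftrightarrow>
     (\<forall>f \<in> graph_edges (complete_graph N) \<rightarrow> {0, 1}.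
        \<exists>c \<in> {0, 1}. contains_copy (color_class (complete_graph N) f c) H)"

definition ramsey_number :: "'a graph \<Rightarrow> nat" where
  "ramsey_number H = (LEAST N. 0 < N \<and> ramsey_for H N)"

text \<open>
  By Ramsey's theorem the minimum defining \<^const>\<open>ramsey_number\<close> is attained for every
  finite simple graph, in particular for the cubes.
\<close>

lemma simple_graph_cube: "simple_graph (cube r)"
proof -
  have "{x, y} \<in> [{..<r} \<rightarrow>\<^sub>E {0, 1::nat}]\<^bsup>2\<^esup>"
    if "x \<in> {..<r} \<rightarrow>\<^sub>E {0, 1}" "y \<in> {..<r} \<rightarrow>\<^sub>E {0, 1}" "card {i. i < r \<and> x i \<noteq> y i} = 1" for x y
  proof -
    have "x \<noteq> y" using that(3) by auto
    then show ?thesis using that(1,2) by simp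
  qed
  then show ?thesis
    by (auto simp: simple_graph_def cube_def intro!: finite_PiE)
qed

lemma ex_ramsey_for:
  fixes H :: "'a graph"
  assumes "simple_graph H"
  shows "\<exists>N>0. ramsey_for H N"
proof -
  let ?V = "graph_verts H"
  let ?k = "card ?V"
  obtain N0 where N0: "N0 \<ge> 1"
    "\<And>(V::nat set) E. finite V \<Longrightarrow> card V \<ge> N0 \<Longrightarrow>
       \<exists>R \<subseteq> V. card R = ?k \<and> clique R E \<or> card R = ?k \<and> indep R E"
    using ramsey2[of ?k ?k] by (metis (no_types, lifting))
  have "ramsey_for H N0"
    unfolding ramsey_for_def
  proof
    fix f :: "nat set \<Rightarrow> nat"
    assume f: "f \<in> graph_edges (complete_graph N0) \<rightarrow> {0, 1}"
    obtain R where R: "R \<subseteq> {..<N0}" "card R = ?k"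
      and mono: "clique R {e. f e = 0} \<or> indep R {e. f e = 0}"
      using N0(2)[of "{..<N0}" "{e. f e = 0}"] by auto
    have "finite R" "finite ?V"
      using R(1) finite_subset assms by (auto simp: simple_graph_def)
    then obtain \<phi> where \<phi>: "bij_betw \<phi> ?V R"
      using R(2) by (metis finite_same_card_bij)
    have *: "\<phi> ` e \<in> [R]\<^bsup>2\<^esup>" if "e \<in> graph_edges H" for e
    proof -
      have "e \<in> [?V]\<^bsup>2\<^esup>" using that assms by (auto simp: simple_graph_def)
      then obtain x y where "e = {x, y}" "x \<in> ?V" "y \<in> ?V" "x \<noteq> y" by (rule nsets2_E)
      then show ?thesis using \<phi> by (auto simp: bij_betw_def inj_on_def)
    qed
    have **: "e \<in> graph_edges (complete_graph N0)" if "e \<in> [R]\<^bsup>2\<^esup>" for e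
      using that nsets_mono[OF R(1)] by (auto simp: complete_graph_def)
    obtain c where c: "c \<in> {0, 1}" "\<And>e. e \<in> [R]\<^bsup>2\<^esup> \<Longrightarrow> f e = c"
      using mono
    proof
      assume "clique R {e. f e = 0}"
      then have "\<And>e. e \<in> [R]\<^bsup>2\<^esup> \<Longrightarrow> f e = 0"
        by (auto elim!: nsets2_E simp: clique_def)
      then show ?thesis using that[of 0] by simp
    next
      assume i: "indep R {e. f e = 0}"
      have "f e = 1" if "e \<in> [R]\<^bsup>2\<^esup>" for e
      proof -
        have "f e \<noteq> 0" using that i by (auto elim!: nsets2_E simp: indep_def)
        moreover have "f e \<in> {0, 1}" using f **[OF that] by (rule funcset_mem)
        ultimately show ?thesis by simp
      qed
      then show ?thesis using that[of 1] by simp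
    qed
    have "contains_copy (color_class (complete_graph N0) f c) H"
      unfolding contains_copy_def color_class_def
      using \<phi> R(1) * ** c(2)
      by (intro exI[of _ \<phi>]) (auto simp: bij_betw_def complete_graph_def)
    with c(1) show "\<exists>c \<in> {0, 1}. contains_copy (color_class (complete_graph N0) f c) H" by blast
  qed
  with N0(1) show ?thesis by (intro exI[of _ N0]) auto
qed

lemma ramsey_number_props:
  assumes "simple_graph H"
  shows "0 < ramsey_number H" "ramsey_for H (ramsey_number H)"
  using LeastI_ex[of "\<lambda>N. 0 < N \<and> ramsey_for H N"] ex_ramsey_for[OF assms]
  by (auto simp: ramsey_number_def)

end

theory Submission
  imports Defs Complex_Main
begin

text \<open>
  Dependent random choice with a single random vertex. For each vertex \<open>v\<close> and colour \<open>c\<close>, call an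
  \<open>r\<close>-tuple of the colour-\<open>c\<close> neighbourhood of \<open>v\<close> bad if it has fewer than \<open>2\<^sup>r\<close> common
  neighbours in colour \<open>c\<close>. A bad tuple lies in fewer than \<open>2\<^sup>r\<close> neighbourhoods, whereas the
  neighbourhoods have about \<open>N / 2\<close> elements on average; so for \<open>N = 2\<^sup>3\<^sup>r\<close> some neighbourhood \<open>U\<close>
  has a proportion of bad tuples below \<open>2\<^sup>1\<^sup>-\<^sup>r\<close>. By the union bound a random map of the even
  vertices of the cube into \<open>U\<close> is injective and makes no neighbourhood of an odd vertex bad.
  The odd vertices are then embedded greedily.
\<close>

section \<open>Random maps and the union bound\<close>

text \<open>A map is determined by its restrictions to \<open>S\<close> and to \<open>A - S\<close>.
  In probabilistic terms, the restriction of a uniform map to \<open>S\<close> is again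
  uniform.\<close>

lemma card_PiE_restrict_le:
  assumes "finite A" "finite U" "S \<subseteq> A" "Z \<subseteq> S \<rightarrow>\<^sub>E U"
  shows "card {f \<in> A \<rightarrow>\<^sub>E U. restrict f S \<in> Z} \<le> card Z * card U ^ (card A - card S)"
proof -
  let ?h = "\<lambda>f. (restrict f S, restrict f (A - S))"
  have "finite S" using assms by (meson finite_subset)
  then have "finite Z" using assms by (meson finite_PiE finite_subset)
  have "inj_on ?h (A \<rightarrow>\<^sub>E U)"
  proof (rule inj_onI)
    fix f g assume f: "f \<in> A \<rightarrow>\<^sub>E U" and g: "g \<in> A \<rightarrow>\<^sub>E U" and eq: "?h f = ?h g"
    show "f = g"
    proof (rule PiE_ext[OF f g])
      fix x assume "x \<in> A"
      then show "f x = g x"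
        using eq by (cases "x \<in> S") (auto dest: fun_cong[where x = x])
    qed
  qed
  then have "inj_on ?h {f \<in> A \<rightarrow>\<^sub>E U. restrict f S \<in> Z}"
    by (rule inj_on_subset) auto
  moreover have "?h ` {f \<in> A \<rightarrow>\<^sub>E U. restrict f S \<in> Z} \<subseteq> Z \<times> ((A - S) \<rightarrow>\<^sub>E U)"
    using assms(3) by (auto dest: PiE_mem split: if_splits)
  moreover have "finite (Z \<times> ((A - S) \<rightarrow>\<^sub>E U))"
    using \<open>finite Z\<close> assms by (auto intro!: finite_PiE)
  ultimately have "card {f \<in> A \<rightarrow>\<^sub>E U. restrict f S \<in> Z} \<le> card (Z \<times> ((A - S) \<rightarrow>\<^sub>E U))"
    using card_inj_on_le by blast
  also have "\<dots> = card Z * card U ^ (card A - card S)"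
    using assms \<open>finite S\<close> by (simp add: card_cartesian_product card_PiE card_Diff_subset)
  finally show ?thesis .
qed

text \<open>Union bound over all maps from \<open>A\<close> to \<open>U\<close>. The bad events are
  a restriction in \<open>Z b\<close> (the sets \<open>X b\<close>) and a collision of an ordered
  pair (the sets \<open>Y p\<close>). Hypothesis \<open>less\<close> says that their probabilities
  add up to less than 1, cleared of the denominator \<open>card U ^ r\<close>.\<close>

lemma ex_injection_avoiding:
  assumes "finite A" "finite B" "finite U"
    and S: "\<And>b. b \<in> B \<Longrightarrow> S b \<subseteq> A" "\<And>b. b \<in> B \<Longrightarrow> card (S b) = r"
    and Z: "\<And>b. b \<in> B \<Longrightarrow> Z b \<subseteq> S b \<rightarrow>\<^sub>E U"
    and r: "0 < r" "r \<le> card A"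
    and less: "(\<Sum>b\<in>B. card (Z b)) + card A * (card A - 1) * card U ^ (r - 1) < card U ^ r"
  shows "\<exists>f \<in> A \<rightarrow>\<^sub>E U. inj_on f A \<and> (\<forall>b\<in>B. restrict f (S b) \<notin> Z b)"
proof (rule ccontr)
  assume none: "\<not> ?thesis"
  let ?n = "card A" and ?d = "card U"
  define P where "P = (SIGMA a:A. A - {a})"
  define X where "X = (\<lambda>b. {f \<in> A \<rightarrow>\<^sub>E U. restrict f (S b) \<in> Z b})"
  define Y where "Y = (\<lambda>(a, a'). {f \<in> A \<rightarrow>\<^sub>E U. f a = f a'})"
  have "finite P" using assms by (auto simp: P_def)
  have card_P: "card P = ?n * (?n - 1)"
    using assms by (simp add: P_def card_SigmaI)
  have finA: "finite (A \<rightarrow>\<^sub>E U)" using assms by (auto intro!: finite_PiE)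
  have card_Y: "card (Y p) \<le> ?d ^ (?n - 1)" if p: "p \<in> P" for p
  proof -
    obtain a a' where aa: "p = (a, a')" "a \<in> A" "a' \<in> A" "a \<noteq> a'"
      using p by (auto simp: P_def)
    have "card (Y p) \<le> card ((A - {a}) \<rightarrow>\<^sub>E U)"
    proof (rule card_inj_on_le)
      show "inj_on (\<lambda>f. restrict f (A - {a})) (Y p)"
      proof (rule inj_onI)
        fix f g assume f: "f \<in> Y p" and g: "g \<in> Y p"
          and eq: "restrict f (A - {a}) = restrict g (A - {a})"
        have *: "f x = g x" if "x \<in> A - {a}" for x
          using fun_cong[OF eq, of x] that by simp
        \<comment> \<open>The value lost at \<open>a\<close> is recovered from \<open>a'\<close>,
          which lies in \<open>A - {a}\<close> and has the same value.\<close>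
        have "f x = g x" if "x \<in> A" for x
          using f g *[of x] *[of a'] that aa by (cases "x = a") (auto simp: Y_def)
        then show "f = g" using f g aa by (intro PiE_ext[of f A "\<lambda>_. U" g]) (auto simp: Y_def)
      qed
      show "(\<lambda>f. restrict f (A - {a})) ` Y p \<subseteq> (A - {a}) \<rightarrow>\<^sub>E U"
        by (auto simp: Y_def dest: PiE_mem split: if_splits)
      show "finite ((A - {a}) \<rightarrow>\<^sub>E U)" using assms by (auto intro!: finite_PiE)
    qed
    also have "\<dots> = ?d ^ (?n - 1)" using assms aa by (simp add: card_PiE)
    finally show ?thesis .
  qed
  have "A \<rightarrow>\<^sub>E U \<subseteq> (\<Union>b\<in>B. X b) \<union> (\<Union>p\<in>P. Y p)"
  proof
    fix f assume f: "f \<in> A \<rightarrow>\<^sub>E U"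
    then consider "\<not> inj_on f A" | b where "b \<in> B" "restrict f (S b) \<in> Z b"
      using none by blast
    then show "f \<in> (\<Union>b\<in>B. X b) \<union> (\<Union>p\<in>P. Y p)"
    proof cases
      case 1
      then obtain a a' where "a \<in> A" "a' \<in> A" "a \<noteq> a'" "f a = f a'" by (auto simp: inj_on_def)
      then have "(a, a') \<in> P" "f \<in> Y (a, a')" using f by (auto simp: P_def Y_def)
      then show ?thesis by blast
    next
      case 2
      then show ?thesis using f by (auto simp: X_def)
    qed
  qed
  moreover have finX: "finite (\<Union>b\<in>B. X b)"
    by (rule finite_subset[OF _ finA]) (auto simp: X_def)
  moreover have finY: "finite (\<Union>p\<in>P. Y p)"
    by (rule finite_subset[OF _ finA]) (auto simp: Y_def)
  ultimately have "card (A \<rightarrow>\<^sub>E U) \<le> card ((\<Union>b\<in>B. X b) \<union> (\<Union>p\<in>P. Y p))"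
    by (meson card_mono finite_UnI)
  also have "\<dots> \<le> card (\<Union>b\<in>B. X b) + card (\<Union>p\<in>P. Y p)" by (rule card_Un_le)
  also have "\<dots> \<le> (\<Sum>b\<in>B. card (X b)) + (\<Sum>p\<in>P. card (Y p))"
    using card_UN_le[OF \<open>finite B\<close>, of X] card_UN_le[OF \<open>finite P\<close>, of Y] by linarith
  also have "\<dots> \<le> (\<Sum>b\<in>B. card (Z b) * ?d ^ (?n - r)) + (\<Sum>p\<in>P. ?d ^ (?n - 1))"
  proof (intro add_mono sum_mono)
    fix b assume b: "b \<in> B"
    show "card (X b) \<le> card (Z b) * ?d ^ (?n - r)"
      using card_PiE_restrict_le[OF assms(1,3) S(1)[OF b] Z[OF b]] S(2)[OF b]
      by (simp add: X_def)
  qed (rule card_Y)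
  also have "\<dots> = ((\<Sum>b\<in>B. card (Z b)) + ?n * (?n - 1) * ?d ^ (r - 1)) * ?d ^ (?n - r)"
  proof -
    have "?d ^ (?n - 1) = ?d ^ (r - 1) * ?d ^ (?n - r)"
      using r by (simp flip: power_add)
    then show ?thesis by (simp add: card_P sum_distrib_right add_mult_distrib)
  qed
  also have "\<dots> < ?d ^ r * ?d ^ (?n - r)"
  proof -
    \<comment> \<open>For empty \<open>U\<close> the right-hand side of \<open>less\<close> would be
      \<open>0 ^ r\<close>, which is 0 because \<open>r\<close> is positive.\<close>
    have "0 < ?d" using less r by (cases "?d = 0") (auto simp: zero_power)
    then show ?thesis using less by (intro mult_strict_right_mono) auto
  qed
  also have "\<dots> = card (A \<rightarrow>\<^sub>E U)"
    using r assms by (simp add: card_PiE flip: power_add)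
  finally show False by simp
qed

section \<open>Common neighbourhoods and the bipartite embedding\<close>

text \<open>When a representative of \<open>x\<close> is due, the values already taken are fewer
  than the elements of \<open>W x\<close>.\<close>

lemma greedy_distinct_representatives:
  assumes "finite B" "\<And>b. b \<in> B \<Longrightarrow> card B \<le> card (W b)"
  shows "\<exists>g. inj_on g B \<and> (\<forall>b\<in>B. g b \<in> W b)"
  using assms
proof (induction B rule: finite_induct)
  case (insert x B)
  have "card B \<le> card (W b)" if "b \<in> B" for b
    using insert.prems[of b] insert.hyps that by simp
  then obtain g where g: "inj_on g B" "\<forall>b\<in>B. g b \<in> W b" using insert.IH by blast
  have "card (g ` B) < card (W x)"
    using insert.prems[of x] insert.hyps g by (simp add: card_image)
  then obtain w where w: "w \<in> W x" "w \<notin> g ` B"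
    using insert.hyps by (meson card_mono finite_imageI leD subsetI)
  have "inj_on (g(x := w)) (insert x B)"
    using g(1) w(2) insert.hyps(2) by (auto simp: inj_on_def)
  moreover have "\<forall>b\<in>insert x B. (g(x := w)) b \<in> W b" using g(2) w(1) by simp
  ultimately show ?case by blast
qed auto

text \<open>Double counting of pairs of a vertex \<open>v\<close> and a bad map \<open>h\<close>:
  the \<open>v\<close> with \<open>h\<close> mapping into \<open>\<Gamma> v\<close> are the very
  common neighbours of the image of \<open>h\<close>, so a bad \<open>h\<close> is counted fewer
  than \<open>M\<close> times.\<close>

lemma sum_bad_maps_le:
  assumes "finite V" "finite S" "\<And>v. v \<in> V \<Longrightarrow> \<Gamma> v \<subseteq> V"
  shows "(\<Sum>v\<in>V. card {h \<in> S \<rightarrow>\<^sub>E \<Gamma> v. card {w \<in> V. h ` S \<subseteq> \<Gamma> w} < M})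
    \<le> M * card V ^ card S"
proof -
  let ?C = "\<lambda>h. {w \<in> V. h ` S \<subseteq> \<Gamma> w}"
  let ?H = "{h \<in> S \<rightarrow>\<^sub>E V. card (?C h) < M}"
  have fin: "finite (S \<rightarrow>\<^sub>E V)" using assms by (auto intro!: finite_PiE)
  then have "finite ?H" by simp
  have "(\<Sum>v\<in>V. card {h \<in> S \<rightarrow>\<^sub>E \<Gamma> v. card (?C h) < M}) = (\<Sum>v\<in>V. card {h \<in> ?H. h ` S \<subseteq> \<Gamma> v})"
  proof (rule sum.cong)
    fix v assume "v \<in> V"
    then have "{h \<in> S \<rightarrow>\<^sub>E \<Gamma> v. card (?C h) < M} = {h \<in> ?H. h ` S \<subseteq> \<Gamma> v}"
      using assms(3)[of v] by (auto simp: PiE_iff)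
    then show "card {h \<in> S \<rightarrow>\<^sub>E \<Gamma> v. card (?C h) < M} = card {h \<in> ?H. h ` S \<subseteq> \<Gamma> v}" by simp
  qed simp
  also have "\<dots> = (\<Sum>h\<in>?H. card (?C h))"
    using sum_multicount_gen[OF \<open>finite V\<close> \<open>finite ?H\<close>,
        of "\<lambda>v h. h ` S \<subseteq> \<Gamma> v" "\<lambda>h. card (?C h)"] by simp
  also have "\<dots> \<le> of_nat (card ?H) * M" by (rule sum_bounded_above) auto
  also have "\<dots> \<le> card V ^ card S * M"
    using card_mono[OF fin, of ?H] assms by (auto simp: card_PiE)
  finally show ?thesis by (simp add: mult.commute)
qed

text \<open>\<open>A\<close> is mapped injectively into \<open>\<Gamma> v\<close> with no
  \<open>S b\<close> becoming bad. The threshold \<open>card A + card B\<close> leaves each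
  \<open>b\<close> at least \<open>card B\<close> candidates outside the image of \<open>A\<close>,
  as many as the greedy choice requires.\<close>

lemma bipartite_embedding:
  assumes "finite V" "finite A" "finite B" "v \<in> V"
    and \<Gamma>: "\<And>v. v \<in> V \<Longrightarrow> \<Gamma> v \<subseteq> V"
    and S: "\<And>b. b \<in> B \<Longrightarrow> S b \<subseteq> A" "\<And>b. b \<in> B \<Longrightarrow> card (S b) = r"
    and r: "0 < r" "r \<le> card A"
    and less: "(\<Sum>b\<in>B. card {h \<in> S b \<rightarrow>\<^sub>E \<Gamma> v. card {w \<in> V. h ` S b \<subseteq> \<Gamma> w} < card A + card B})
      + card A * (card A - 1) * card (\<Gamma> v) ^ (r - 1) < card (\<Gamma> v) ^ r"
  shows "\<exists>f g. inj_on f A \<and> inj_on g B \<and> f ` A \<subseteq> V \<and> g ` B \<subseteq> V \<and> f ` A \<inter> g ` B = {} \<and>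
    (\<forall>b\<in>B. \<forall>a\<in>S b. f a \<in> \<Gamma> (g b))"
proof -
  have "finite (\<Gamma> v)" using \<Gamma> assms by (meson finite_subset)
  define Z where "Z = (\<lambda>b. {h \<in> S b \<rightarrow>\<^sub>E \<Gamma> v. card {w \<in> V. h ` S b \<subseteq> \<Gamma> w} < card A + card B})"
  have "\<exists>f \<in> A \<rightarrow>\<^sub>E \<Gamma> v. inj_on f A \<and> (\<forall>b\<in>B. restrict f (S b) \<notin> Z b)"
    using less by (intro ex_injection_avoiding[OF assms(2,3) \<open>finite (\<Gamma> v)\<close> S _ r])
      (auto simp: Z_def)
  then obtain f where f: "f \<in> A \<rightarrow>\<^sub>E \<Gamma> v" "inj_on f A" "\<And>b. b \<in> B \<Longrightarrow> restrict f (S b) \<notin> Z b"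
    by blast
  define W where "W = (\<lambda>b. {w \<in> V. f ` S b \<subseteq> \<Gamma> w})"
  have "card B \<le> card (W b - f ` A)" if b: "b \<in> B" for b
  proof -
    have "restrict f (S b) \<in> S b \<rightarrow>\<^sub>E \<Gamma> v" using f(1) S(1)[OF b] by auto
    then have "card A + card B \<le> card (W b)"
      using f(3)[OF b] by (auto simp: Z_def W_def)
    moreover have "card (W b) - card (f ` A) \<le> card (W b - f ` A)"
      using \<open>finite A\<close> by (intro diff_card_le_card_Diff) auto
    ultimately show ?thesis using card_image[OF f(2)] by simp
  qed
  from greedy_distinct_representatives[OF \<open>finite B\<close>, of "\<lambda>b. W b - f ` A", OF this]
  obtain g where g: "inj_on g B" "\<forall>b\<in>B. g b \<in> W b - f ` A" by blast
  have g': "g b \<in> V" "f ` S b \<subseteq> \<Gamma> (g b)" "g b \<notin> f ` A" if "b \<in> B" for b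
    using bspec[OF g(2) that] by (simp_all add: W_def)
  have "f ` A \<subseteq> V" using f(1) \<Gamma>[OF \<open>v \<in> V\<close>] by auto
  moreover have "g ` B \<subseteq> V" using g'(1) by (rule image_subsetI)
  moreover have "f ` A \<inter> g ` B = {}"
  proof (rule Int_emptyI)
    fix w assume "w \<in> f ` A" "w \<in> g ` B"
    then show False using g'(3) by (elim imageE[of w g B]) simp
  qed
  moreover have "f a \<in> \<Gamma> (g b)" if "b \<in> B" "a \<in> S b" for a b
    using g'(2)[OF that(1)] imageI[OF that(2)] by (rule subsetD)
  ultimately show ?thesis
    using f(2) g(1) by (intro exI[of _ f] exI[of _ g] conjI ballI)
qed

section \<open>Convexity and averaging over neighbourhoods\<close>

text \<open>By comparison with the tangent at \<open>m\<close>.\<close>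

lemma two_point_power_mean:
  fixes m x y :: real
  assumes "0 < m" "0 \<le> x" "0 \<le> y" "2 * m \<le> x + y"
  shows "2 * m ^ r \<le> x ^ r + y ^ r"
proof -
  have tangent: "m ^ r * (1 + r * (z / m - 1)) \<le> z ^ r" if "0 \<le> z" for z
  proof -
    have "1 + r * (z / m - 1) \<le> (1 + (z / m - 1)) ^ r"
      using assms that by (intro Bernoulli_inequality) auto
    also have "\<dots> = z ^ r / m ^ r" by (simp add: power_divide)
    finally show ?thesis using assms by (simp add: field_simps)
  qed
  \<comment> \<open>The tangent has nonnegative slope, so an excess of \<open>x + y\<close> over
    \<open>2 * m\<close> can only raise the sum of the two tangent values.\<close>
  have "0 \<le> m ^ r * r * ((x + y - 2 * m) / m)" using assms by simp
  moreover have "m ^ r * (1 + r * (x / m - 1)) + m ^ r * (1 + r * (y / m - 1))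
      = 2 * m ^ r + m ^ r * r * ((x + y - 2 * m) / m)"
    using assms by (simp add: field_simps)
  ultimately show ?thesis using tangent[OF assms(2)] tangent[OF assms(3)] by linarith
qed

text \<open>
  The collisions of a random map cost \<open>k * d ^ (r - 1)\<close> in a neighbourhood of size \<open>d\<close>. What is
  left of \<open>d ^ r\<close> is bounded below by \<open>(d - k) ^ r\<close>, whose subtraction has to be truncated: this
  keeps the bound convex in \<open>d\<close>, and a vertex with \<open>d \<le> k\<close> contributes \<open>0\<close>.
\<close>

lemma degree_power_bound:
  fixes r d0 d1 :: nat
  assumes "0 < r" and d: "d0 + d1 = 2 ^ (3 * r) - 1"
  defines "k \<equiv> 2 ^ (r - 1) * (2 ^ (r - 1) - 1)"
  shows "2 ^ (2 * r) * 2 ^ (3 * r * (r - 1)) < (d0 - k) ^ r + (d1 - k) ^ r"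
proof -
  obtain s where s: "r = Suc s" using assms by (cases r) auto
  \<comment> \<open>A lower bound for the mean of the two truncated degrees: \<open>2 * m\<close> is
    \<open>2 ^ (3 * r) - 2 ^ (2 * r - 1)\<close>, and the subtracted term is at least
    \<open>2 * k + 1\<close>, where the 1 stands for the vertex missing from the degree sum.\<close>
  define m where "m = 2 ^ (3 * r - 1) * (1 - 1 / 2 ^ (r + 1) :: real)"
  have p1: "(1::real) \<le> 2 ^ s" by simp
  have "2 * m \<le> real (d0 - k) + real (d1 - k)"
  proof -
    have k: "real k = 2 ^ s * (2 ^ s - 1)" by (simp add: k_def s of_nat_diff)
    have "real d0 + real d1 = 2 ^ (3 * r) - 1"
      using arg_cong[OF d, of real] by (simp add: of_nat_diff)
    moreover have "2 * m = 2 ^ (3 * r) - 2 * (2 ^ s * 2 ^ s)"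
      by (simp add: m_def s field_simps power_add power_mult power3_eq_cube)
    moreover have "2 * real k + 1 \<le> 2 * (2 ^ s * 2 ^ s)"
      using p1 unfolding k right_diff_distrib by linarith
    ultimately show ?thesis by linarith
  qed
  moreover have "0 < m"
    using one_less_power[of "2::real" "r + 1"] by (simp add: m_def)
  ultimately have "2 * m ^ r \<le> real (d0 - k) ^ r + real (d1 - k) ^ r"
    by (intro two_point_power_mean) auto
  moreover have "2 ^ (2 * r) * 2 ^ (3 * r * (r - 1)) < 2 * m ^ r"
  proof -
    \<comment> \<open>The left-hand side is the \<open>r\<close>-th power of
      \<open>2 ^ (3 * r - 1)\<close>, half the number of vertices. The loss factor
      \<open>(1 - 1 / 2 ^ (r + 1)) ^ r\<close> exceeds 1/2, so the factor 2 from the two colours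
      outweighs it.\<close>
    have "real r < 2 ^ r" by (simp add: of_nat_less_two_power)
    then have "1 / 2 < 1 + real r * (- (1 / 2 ^ (r + 1)) :: real)"
      by (simp add: field_simps)
    also have "\<dots> \<le> (1 + (- (1 / 2 ^ (r + 1)))) ^ r"
      using one_le_power[of "2::real" "r + 1"] by (intro Bernoulli_inequality) simp
    finally have "(1::real) < 2 * (1 - 1 / 2 ^ (r + 1)) ^ r"
      by simp
    then have "(2::real) ^ ((3 * r - 1) * r) * 1
        < 2 ^ ((3 * r - 1) * r) * (2 * (1 - 1 / 2 ^ (r + 1)) ^ r)"
      by (intro mult_strict_left_mono) auto
    also have "\<dots> = 2 * m ^ r" by (simp add: m_def power_mult_distrib power_mult)
    also have "(2::real) ^ ((3 * r - 1) * r) * 1 = 2 ^ (2 * r) * 2 ^ (3 * r * (r - 1))"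
      by (simp add: s algebra_simps flip: power_add)
    finally show ?thesis .
  qed
  ultimately have "real (2 ^ (2 * r) * 2 ^ (3 * r * (r - 1))) < real ((d0 - k) ^ r + (d1 - k) ^ r)"
    by simp
  then show ?thesis by (simp only: of_nat_less_iff)
qed

text \<open>Averaging over both colours and all vertices. Double counting bounds the total number of
  bad maps by exactly \<open>card V\<close> times the left-hand side of
  \<open>degree_power_bound\<close>. Since that bound is strict, some \<open>\<Gamma> c v\<close>
  has fewer than \<open>(card (\<Gamma> c v) - k) ^ r\<close> of them.\<close>

lemma ex_good_neighbourhood:
  fixes \<Gamma> :: "nat \<Rightarrow> 'v \<Rightarrow> 'v set"
  assumes "0 < r" "finite V" and V: "card V = 2 ^ (3 * r)"
    and "finite B" and B: "card B = 2 ^ (r - 1)"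
    and S: "\<And>b. b \<in> B \<Longrightarrow> finite (S b)" "\<And>b. b \<in> B \<Longrightarrow> card (S b) = r"
    and \<Gamma>: "\<And>c v. v \<in> V \<Longrightarrow> \<Gamma> c v \<subseteq> V"
    and deg: "\<And>v. v \<in> V \<Longrightarrow> card (\<Gamma> 0 v) + card (\<Gamma> 1 v) = card V - 1"
  shows "\<exists>c\<in>{0, 1}. \<exists>v\<in>V.
    (\<Sum>b\<in>B. card {h \<in> S b \<rightarrow>\<^sub>E \<Gamma> c v. card {w \<in> V. h ` S b \<subseteq> \<Gamma> c w} < 2 ^ r})
      + 2 ^ (r - 1) * (2 ^ (r - 1) - 1) * card (\<Gamma> c v) ^ (r - 1) < card (\<Gamma> c v) ^ r"
proof -
  define k :: nat where "k = 2 ^ (r - 1) * (2 ^ (r - 1) - 1)"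
  define \<Phi> where
    "\<Phi> = (\<lambda>c v. \<Sum>b\<in>B. card {h \<in> S b \<rightarrow>\<^sub>E \<Gamma> c v. card {w \<in> V. h ` S b \<subseteq> \<Gamma> c w} < 2 ^ r})"
  have sum_\<Phi>: "(\<Sum>v\<in>V. \<Phi> c v) \<le> 2 ^ (r - 1) * (2 ^ r * card V ^ r)" for c
  proof -
    have "(\<Sum>v\<in>V. \<Phi> c v) = (\<Sum>b\<in>B. \<Sum>v\<in>V.
        card {h \<in> S b \<rightarrow>\<^sub>E \<Gamma> c v. card {w \<in> V. h ` S b \<subseteq> \<Gamma> c w} < 2 ^ r})"
      unfolding \<Phi>_def by (rule sum.swap)
    also have "\<dots> \<le> (\<Sum>b\<in>B. 2 ^ r * card V ^ r)"
    proof (rule sum_mono)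
      fix b assume b: "b \<in> B"
      show "(\<Sum>v\<in>V. card {h \<in> S b \<rightarrow>\<^sub>E \<Gamma> c v. card {w \<in> V. h ` S b \<subseteq> \<Gamma> c w} < 2 ^ r})
          \<le> 2 ^ r * card V ^ r"
        using sum_bad_maps_le[OF \<open>finite V\<close> S(1)[OF b], of "\<Gamma> c" "2 ^ r"] \<Gamma> S(2)[OF b] by simp
    qed
    finally show ?thesis by (simp add: B)
  qed
  have "\<exists>c\<in>{0, 1}. \<exists>v\<in>V. \<Phi> c v < (card (\<Gamma> c v) - k) ^ r"
  proof (rule ccontr)
    assume "\<not> ?thesis"
    then have le: "(card (\<Gamma> 0 v) - k) ^ r + (card (\<Gamma> 1 v) - k) ^ r \<le> \<Phi> 0 v + \<Phi> 1 v"
      if "v \<in> V" for v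
      using that by (auto intro!: add_mono simp: not_less)
    have "V \<noteq> {}" using V by auto
    then have "(\<Sum>v\<in>V. 2 ^ (2 * r) * 2 ^ (3 * r * (r - 1))) < (\<Sum>v\<in>V. \<Phi> 0 v + \<Phi> 1 v)"
    proof (intro sum_strict_mono \<open>finite V\<close>)
      fix v assume v: "v \<in> V"
      have "2 ^ (2 * r) * 2 ^ (3 * r * (r - 1))
          < (card (\<Gamma> 0 v) - k) ^ r + (card (\<Gamma> 1 v) - k) ^ r"
        unfolding k_def using deg[OF v] V by (intro degree_power_bound \<open>0 < r\<close>) simp
      then show "2 ^ (2 * r) * 2 ^ (3 * r * (r - 1)) < \<Phi> 0 v + \<Phi> 1 v"
        using le[OF v] by linarith
    qed
    also have "\<dots> \<le> 2 * (2 ^ (r - 1) * (2 ^ r * card V ^ r))"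
      using sum_\<Phi>[of 0] sum_\<Phi>[of 1] by (simp add: sum.distrib)
    also have "\<dots> = (\<Sum>v\<in>V. 2 ^ (2 * r) * 2 ^ (3 * r * (r - 1)))"
    proof -
      obtain s where "r = Suc s" using \<open>0 < r\<close> by (cases r) auto
      then show ?thesis
        by (simp add: V algebra_simps flip: power_add power_mult power_Suc)
    qed
    finally show False by simp
  qed
  then obtain c v where cv: "c \<in> {0, 1}" "v \<in> V" "\<Phi> c v < (card (\<Gamma> c v) - k) ^ r" by blast
  let ?d = "card (\<Gamma> c v)"
  \<comment> \<open>Otherwise the truncated difference, and with it its power, would be 0, and no
    natural number is below that.\<close>
  have "k < ?d" using cv(3) \<open>0 < r\<close> by (cases "k < ?d") (auto simp: zero_power)
  \<comment> \<open>Back from the convex bound to the collision term: \<open>(d - k) ^ r\<close> is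
    at most \<open>d ^ r - k * d ^ (r - 1)\<close>.\<close>
  have "(?d - k) ^ r = (?d - k) * (?d - k) ^ (r - 1)"
    using power_minus_mult[OF \<open>0 < r\<close>] by (metis mult.commute)
  also have "\<dots> \<le> (?d - k) * ?d ^ (r - 1)" by (intro mult_left_mono power_mono) auto
  finally have "(?d - k) ^ r \<le> (?d - k) * ?d ^ (r - 1)" .
  moreover have "(?d - k) * ?d ^ (r - 1) + k * ?d ^ (r - 1) = ?d * ?d ^ (r - 1)"
    using \<open>k < ?d\<close> by (simp flip: add_mult_distrib)
  moreover have "\<dots> = ?d ^ r"
    using power_minus_mult[OF \<open>0 < r\<close>] by (metis mult.commute)
  ultimately have "\<Phi> c v + k * ?d ^ (r - 1) < ?d ^ r" using cv(3) by linarith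
  then show ?thesis using cv(1,2) unfolding \<Phi>_def k_def by blast
qed

section \<open>Coordinate flips and the parity of cube vertices\<close>

text \<open>Truncated subtraction swaps 0 and 1 but sends larger values to 0, whence the assumption
  of cube membership in the lemmas below.\<close>

definition flip :: "nat \<Rightarrow> (nat \<Rightarrow> nat) \<Rightarrow> nat \<Rightarrow> nat" where
  "flip i x = x(i := 1 - x i)"

lemma flip_in_cube:
  assumes "x \<in> {..<r} \<rightarrow>\<^sub>E {0, 1}" "i < r"
  shows "flip i x \<in> {..<r} \<rightarrow>\<^sub>E {0, 1}"
proof (rule PiE_I)
  fix j assume "j \<in> {..<r}"
  then have "x j \<in> {0, 1}" using assms by auto
  then show "flip i x j \<in> {0, 1}" by (auto simp: flip_def)
next
  fix j assume "j \<notin> {..<r}"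
  then show "flip i x j = undefined" using assms PiE_arb[OF assms(1)] by (auto simp: flip_def)
qed

lemma flip_flip:
  assumes "x \<in> {..<r} \<rightarrow>\<^sub>E {0, 1}" "i < r"
  shows "flip i (flip i x) = x"
proof -
  have "x i \<in> {0, 1}" using assms by auto
  then show ?thesis by (auto simp: flip_def)
qed

text \<open>Only summand \<open>i\<close> changes, between 0 and 1. Parity thus gives the
  bipartition of the cube.\<close>

lemma even_sum_flip:
  assumes "x \<in> {..<r} \<rightarrow>\<^sub>E {0, 1}" "i < r"
  shows "even (\<Sum>j<r. flip i x j) \<longleftrightarrow> odd (\<Sum>j<r. x j)"
proof -
  have "x i \<in> {0, 1}" using assms by auto
  moreover have "(\<Sum>j<r. g j) = g i + (\<Sum>j\<in>{..<r} - {i}. g j)" for g :: "nat \<Rightarrow> nat"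
    using assms(2) by (simp add: sum.remove)
  moreover have "(\<Sum>j\<in>{..<r} - {i}. flip i x j) = (\<Sum>j\<in>{..<r} - {i}. x j)"
    by (rule sum.cong) (auto simp: flip_def)
  ultimately show ?thesis by (auto simp: flip_def)
qed

lemma inj_on_flip:
  assumes "x \<in> {..<r} \<rightarrow>\<^sub>E {0, 1}"
  shows "inj_on (\<lambda>i. flip i x) {..<r}"
proof (rule inj_onI)
  fix i j assume ij: "i \<in> {..<r}" "j \<in> {..<r}" "flip i x = flip j x"
  show "i = j"
  proof (rule ccontr)
    assume "i \<noteq> j"
    moreover have "x i \<in> {0, 1}" using assms ij by auto
    ultimately show False using fun_cong[OF ij(3), of i] by (auto simp: flip_def)
  qed
qed

lemma cube_edge_flip:
  assumes x: "x \<in> {..<r} \<rightarrow>\<^sub>E {0, 1}" and y: "y \<in> {..<r} \<rightarrow>\<^sub>E {0, 1}"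
    and "card {i. i < r \<and> x i \<noteq> y i} = 1"
  obtains i where "i < r" "y = flip i x"
proof -
  obtain i where i: "{i. i < r \<and> x i \<noteq> y i} = {i}" using assms(3) by (rule card_1_singletonE)
  have "i < r" using i by blast
  moreover have "y = flip i x"
  proof (rule PiE_ext[OF y flip_in_cube[OF x \<open>i < r\<close>]])
    fix j assume j: "j \<in> {..<r}"
    have "x j \<in> {0, 1}" "y j \<in> {0, 1}" using x y j by auto
    moreover have "x j \<noteq> y j \<longleftrightarrow> j = i" using i j by blast
    ultimately show "y j = flip i x j" by (auto simp: flip_def)
  qed
  ultimately show ?thesis by (rule that)
qed

section \<open>Embedding the cube in one colour\<close>

lemma ramsey_for_cube:
  assumes "0 < r"
  shows "ramsey_for (cube r) (2 ^ (3 * r))"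
  unfolding ramsey_for_def
proof
  let ?N = "2 ^ (3 * r) :: nat"
  fix f :: "nat set \<Rightarrow> nat" assume f: "f \<in> graph_edges (complete_graph ?N) \<rightarrow> {0, 1}"
  define V where "V = {..<?N}"
  define Q where "Q = {..<r} \<rightarrow>\<^sub>E {0, 1::nat}"
  define A where "A = {x \<in> Q. even (\<Sum>i<r. x i)}"
  define B where "B = {x \<in> Q. odd (\<Sum>i<r. x i)}"
  \<comment> \<open>The neighbours of a vertex in the cube, all of opposite parity.\<close>
  define S where "S = (\<lambda>x. (\<lambda>i. flip i x) ` {..<r})"
  define \<Gamma> where "\<Gamma> = (\<lambda>c v. {w \<in> V. w \<noteq> v \<and> f {v, w} = c})"
  have "finite Q" by (auto simp: Q_def intro!: finite_PiE)
  then have fin: "finite A" "finite B" by (auto simp: A_def B_def)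
  have AB: "A \<union> B = Q" "A \<inter> B = {}" by (auto simp: A_def B_def)
  have flip: "flip i x \<in> Q" "flip i (flip i x) = x"
      "even (\<Sum>j<r. flip i x j) \<longleftrightarrow> odd (\<Sum>j<r. x j)" "inj_on (\<lambda>i. flip i x) {..<r}"
    if "x \<in> Q" "i < r" for i x
    using that flip_in_cube[of x r i] flip_flip[of x r i] even_sum_flip[of x r i]
      inj_on_flip[of x r] by (simp_all add: Q_def)
  \<comment> \<open>Coordinate 0 exists because \<open>r\<close> is positive; flipping it shows that
    both parity classes are half of the cube.\<close>
  have "bij_betw (flip 0) A B"
    by (rule bij_betw_byWitness[where f' = "flip 0"]) (use assms flip in \<open>auto simp: A_def B_def\<close>)
  then have "card A = card B" by (rule bij_betw_same_card)
  moreover have "card A + card B = 2 ^ r"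
    using card_Un_disjoint[OF fin AB(2)] by (simp add: AB Q_def card_PiE numeral_2_eq_2)
  ultimately have card: "card A = 2 ^ (r - 1)" "card B = 2 ^ (r - 1)" "card A + card B = 2 ^ r"
    using power_minus_mult[OF assms, of "2::nat"] by simp_all
  have S: "S b \<subseteq> A" "card (S b) = r" if "b \<in> B" for b
    using that flip[of b] assms by (auto simp: S_def A_def B_def card_image)
  have \<Gamma>: "\<Gamma> c v \<subseteq> V" for c v by (auto simp: \<Gamma>_def)
  have deg: "card (\<Gamma> 0 v) + card (\<Gamma> 1 v) = card V - 1" if v: "v \<in> V" for v
  proof -
    have "f {v, w} \<in> {0, 1}" if "w \<in> V" "w \<noteq> v" for w
      using v that by (intro funcset_mem[OF f]) (auto simp: complete_graph_def V_def)
    then have "\<Gamma> 0 v \<union> \<Gamma> 1 v = V - {v}" by (auto simp: \<Gamma>_def)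
    moreover have "\<Gamma> 0 v \<inter> \<Gamma> 1 v = {}" by (auto simp: \<Gamma>_def)
    moreover have "finite (\<Gamma> c v)" for c by (auto simp: \<Gamma>_def V_def)
    ultimately have "card (V - {v}) = card (\<Gamma> 0 v) + card (\<Gamma> 1 v)"
      using card_Un_disjoint by metis
    then show ?thesis using v by (simp add: V_def)
  qed
  have "\<exists>c\<in>{0, 1}. \<exists>v\<in>V.
    (\<Sum>b\<in>B. card {h \<in> S b \<rightarrow>\<^sub>E \<Gamma> c v. card {w \<in> V. h ` S b \<subseteq> \<Gamma> c w} < 2 ^ r})
      + 2 ^ (r - 1) * (2 ^ (r - 1) - 1) * card (\<Gamma> c v) ^ (r - 1) < card (\<Gamma> c v) ^ r"
    using assms \<Gamma> deg S fin card
    by (intro ex_good_neighbourhood) (auto simp: V_def S_def)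
  \<comment> \<open>The threshold \<open>2 ^ r\<close> is read as the number of all cube vertices,
    and \<open>2 ^ (r - 1)\<close> as the number of even ones, to match
    \<open>bipartite_embedding\<close>.\<close>
  then obtain c v where c: "c \<in> {0, 1}" and v: "v \<in> V" and less:
    "(\<Sum>b\<in>B. card {h \<in> S b \<rightarrow>\<^sub>E \<Gamma> c v. card {w \<in> V. h ` S b \<subseteq> \<Gamma> c w} < card A + card B})
      + card A * (card A - 1) * card (\<Gamma> c v) ^ (r - 1) < card (\<Gamma> c v) ^ r"
    unfolding card(3) unfolding card(1) by blast
  have "r \<le> card A"
    using less_exp[of "r - 1"] assms unfolding card by linarith
  moreover have "finite V" by (simp add: V_def)
  ultimately have "\<exists>p q. inj_on p A \<and> inj_on q B \<and> p ` A \<subseteq> V \<and> q ` B \<subseteq> V \<and>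
      p ` A \<inter> q ` B = {} \<and> (\<forall>b\<in>B. \<forall>a\<in>S b. p a \<in> \<Gamma> c (q b))"
    by (intro bipartite_embedding[OF _ fin v \<Gamma> S assms _ less])
  then obtain p q where pq: "inj_on p A" "inj_on q B" "p ` A \<subseteq> V" "q ` B \<subseteq> V"
      "p ` A \<inter> q ` B = {}" "\<forall>b\<in>B. \<forall>a\<in>S b. p a \<in> \<Gamma> c (q b)"
    by (elim exE conjE)
  define \<phi> where "\<phi> = (\<lambda>x. if x \<in> A then p x else q x)"
  have \<phi>A: "\<phi> a = p a" if "a \<in> A" for a using that by (simp add: \<phi>_def)
  have \<phi>B: "\<phi> b = q b" if "b \<in> B" for b using that AB by (auto simp: \<phi>_def)
  have img: "\<phi> ` A = p ` A" "\<phi> ` B = q ` B" using \<phi>A \<phi>B by (simp_all cong: image_cong)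
  have "inj_on \<phi> A" "inj_on \<phi> B"
    using pq(1,2) \<phi>A \<phi>B by (simp_all cong: inj_on_cong)
  then have inj: "inj_on \<phi> Q"
    using pq(5) img unfolding AB(1)[symmetric] inj_on_Un by blast
  \<comment> \<open>Every cube edge has exactly one odd end, so it suffices to treat edges seen from
    that end, where \<open>q b\<close> was chosen adjacent to the images of all of
    \<open>S b\<close>.\<close>
  have odd_edge: "\<phi> ` {flip i b, b} \<in> graph_edges (color_class (complete_graph ?N) f c)"
    if b: "b \<in> B" and i: "i < r" for b i
  proof -
    have "flip i b \<in> S b" using i by (auto simp: S_def)
    then have "p (flip i b) \<in> \<Gamma> c (q b)" "flip i b \<in> A" using pq(6) S b by auto
    moreover have "q b \<in> V" using pq(4) b by auto
    ultimately show ?thesis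
      using \<phi>A \<phi>B b
      by (auto simp: \<Gamma>_def color_class_def complete_graph_def V_def insert_commute)
  qed
  have "\<phi> ` e \<in> graph_edges (color_class (complete_graph ?N) f c)"
    if "e \<in> graph_edges (cube r)" for e
  proof -
    obtain x y where xy: "e = {x, y}" "x \<in> Q" "y \<in> Q" "card {i. i < r \<and> x i \<noteq> y i} = 1"
      using \<open>e \<in> graph_edges (cube r)\<close> by (auto simp: cube_def Q_def)
    obtain i where i: "i < r" "y = flip i x" using cube_edge_flip xy unfolding Q_def by blast
    then have x: "x = flip i y" using flip xy by simp
    show ?thesis
    proof (cases "x \<in> B")
      case True
      then show ?thesis using odd_edge[of x i] i xy(1) by (simp add: insert_commute)
    next
      case False
      then have "y \<in> B"
        using flip(3)[of x i] i xy by (auto simp: B_def)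
      then show ?thesis using odd_edge[of y i] i(1) x xy(1) by simp
    qed
  qed
  moreover have "\<phi> ` Q \<subseteq> V"
    using pq(3,4) img by (simp add: image_Un flip: AB(1))
  ultimately have "contains_copy (color_class (complete_graph ?N) f c) (cube r)"
    unfolding contains_copy_def using inj
    by (intro exI[of _ \<phi>]) (auto simp: color_class_def complete_graph_def cube_def Q_def V_def)
  with c show "\<exists>c\<in>{0, 1}. contains_copy (color_class (complete_graph ?N) f c) (cube r)" by blast
qed

theorem theorem3p4:
  fixes r :: nat
  assumes "0 < r"
  shows "ramsey_number (cube r) \<le> 2 ^ (3 * r)"
  unfolding ramsey_number_def using ramsey_for_cube[OF assms] by (simp add: Least_le)

end
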